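(* Given integers $a,b>0$ with $a\mid b$, the value $\mathrm{alcm}_a b$ can be computed in time polynomial in $\log_2 b$.
   Context: For integers $a,b>0$ with $a\mid b$, the anti-lcm $\mathrm{alcm}_a b$ of $b$ with respect to $a$ is the smallest positive integer $c$ such that $\lcm(a,c)=b$. *)

theory Defs
  imports
    Complex_Main
    "HOL-Computational_Algebra.Polynomial"
    "HOL-Library.Discrete_Functions"
begin

definition alcm :: "nat \<Rightarrow> nat \<Rightarrow> nat" where
  "alcm a b = (LEAST c. 0 < c \<and> lcm a c = b)"

lemma alcm_welldefined:
  assumes "0 < a" "0 < b" "a dvd b"
  shows "0 < alcm a b \<and> lcm a (alcm a b) = b"
  unfolding alcm_def by (rule LeastI[where k = b]) (use assms in \<open>auto intro: lcm_proj2_if_dvd\<close>)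

text \<open>
  The model of computation is the random access machine of Cook and Reckhow with
  logarithmic (bit) cost, which is polynomially equivalent to Turing machines.
  There are infinitely many integer registers, indexed by natural numbers. Apart from
  constants, copying (possibly through indirect addressing) and conditional jumps, only
  addition and subtraction are primitive. Instead of instructions for reading and printing,
  the input is placed in an initial segment of the registers, and the output is register 0.
\<close>

datatype instr =
    LoadConst nat int     \<comment> \<open>\<open>X\<^sub>i := z\<close>\<close>
  | Add nat nat nat       \<comment> \<open>\<open>X\<^sub>i := X\<^sub>j + X\<^sub>k\<close>\<close>
  | Sub nat nat nat       \<comment> \<open>\<open>X\<^sub>i := X\<^sub>j - X\<^sub>k\<close>\<close>
  | LoadInd nat nat       \<comment> \<open>\<open>X\<^sub>i := X\<^bsub>X\<^sub>j\<^esub>\<close>\<close>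
  | StoreInd nat nat      \<comment> \<open>\<open>X\<^bsub>X\<^sub>i\<^esub> := X\<^sub>j\<close>\<close>
  | JumpPos nat nat       \<comment> \<open>go to instruction \<open>l\<close> if \<open>X\<^sub>j > 0\<close>\<close>

type_synonym memory = "nat \<Rightarrow> int"

type_synonym config = "nat \<times> memory"

text \<open>A negative indirect address leaves the machine without a successor configuration.\<close>

fun exec :: "instr \<Rightarrow> config \<Rightarrow> config option" where
  "exec (LoadConst i z) (pc, m) = Some (Suc pc, m(i := z))"
| "exec (Add i j k) (pc, m) = Some (Suc pc, m(i := m j + m k))"
| "exec (Sub i j k) (pc, m) = Some (Suc pc, m(i := m j - m k))"
| "exec (LoadInd i j) (pc, m) =
     (if m j < 0 then None else Some (Suc pc, m(i := m (nat (m j)))))"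
| "exec (StoreInd i j) (pc, m) =
     (if m i < 0 then None else Some (Suc pc, m(nat (m i) := m j)))"
| "exec (JumpPos l j) (pc, m) = Some (if 0 < m j then l else Suc pc, m)"

text \<open>
  The number of binary digits of \<open>\<bar>z\<bar>\<close>, where \<open>0\<close> has one digit
  (note that \<^term>\<open>floor_log 0 = 0\<close>).
\<close>

definition bit_len :: "int \<Rightarrow> nat" where
  "bit_len z = floor_log (nat \<bar>z\<bar>) + 1"

fun cost :: "instr \<Rightarrow> memory \<Rightarrow> nat" where
  "cost (LoadConst i z) m = bit_len z"
| "cost (Add i j k) m = bit_len (m j) + bit_len (m k)"
| "cost (Sub i j k) m = bit_len (m j) + bit_len (m k)"
| "cost (LoadInd i j) m = bit_len (m j) + bit_len (m (nat (m j)))"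
| "cost (StoreInd i j) m = bit_len (m i) + bit_len (m j)"
| "cost (JumpPos l j) m = bit_len (m j)"

inductive run :: "instr list \<Rightarrow> config \<Rightarrow> nat \<Rightarrow> config \<Rightarrow> bool" for P where
  run_refl: "run P c 0 c"
| run_step: "pc < length P \<Longrightarrow> exec (P ! pc) (pc, m) = Some c' \<Longrightarrow> run P c' t c'' \<Longrightarrow>
    run P (pc, m) (cost (P ! pc) m + t) c''"

definition input_memory :: "int list \<Rightarrow> memory" where
  "input_memory xs = (\<lambda>i. if i < length xs then xs ! i else 0)"

text \<open>
  The program \<open>P\<close> halts on input \<open>xs\<close> after total cost exactly \<open>t\<close> with output \<open>y\<close>.
  The machine halts when the program counter leaves the program.
\<close>

definition ram_computes :: "instr list \<Rightarrow> int list \<Rightarrow> int \<Rightarrow> nat \<Rightarrow> bool" where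
  "ram_computes P xs y t \<longleftrightarrow>
     (\<exists>pc m. run P (0, input_memory xs) t (pc, m) \<and> length P \<le> pc \<and> m 0 = y)"

lemma run_halting_unique:
  assumes "run P c t (pc, m)" "length P \<le> pc" "run P c t' (pc', m')" "length P \<le> pc'"
  shows "t = t' \<and> pc = pc' \<and> m = m'"
  using assms
proof (induction c t "(pc, m)" arbitrary: t' rule: run.induct)
  case run_refl
  then show ?case by (auto elim: run.cases)
next
  case (run_step pc1 m1 c' t)
  from run_step.prems(2) show ?case
    by (cases rule: run.cases) (use run_step in auto)
qed

lemma ram_computes_unique:
  "ram_computes P xs y t \<Longrightarrow> ram_computes P xs y' t' \<Longrightarrow> y = y' \<and> t = t'"
  unfolding ram_computes_def using run_halting_unique by blast

end

theory Submission
  imports Defs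
begin

text \<open>
  Let \<open>d = b / a\<close> and let \<open>f\<close> be the largest divisor of \<open>b\<close> coprime to \<open>d\<close>; then
  \<open>alcm a b = b / f\<close>. One obtains \<open>f\<close> from \<open>b\<close> by replacing \<open>f\<close> with \<open>f / gcd d f\<close> until it is
  stable, which takes at most \<open>log\<^sub>2 b + 1\<close> rounds. So all three stages are instances of
  \<open>(x, y) \<mapsto> y / gcd x y\<close>, as \<open>b / a = b / gcd a b\<close> and \<open>b / f = b / gcd f b\<close>.

  This map needs only additions: run Euclid's algorithm, subtracting from the larger of \<open>x\<close>, \<open>y\<close>
  a multiple \<open>2\<^sup>i\<close> of the smaller that at least halves it, and carry along cofactors
  \<open>u, v \<ge> 0\<close> such that \<open>x v + y u\<close> is constant. When \<open>x\<close> has become \<open>0\<close>, \<open>y\<close> is the gcd and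
  \<open>u\<close> is the wanted quotient.
\<close>

section \<open>The anti-lcm as a complementary divisor\<close>

text \<open>Here \<open>f\<close> carries the part of \<open>b\<close> coprime to \<open>d\<close>,
  while \<open>c\<close> divides a power of \<open>d\<close>. If \<open>lcm a c' = b\<close> and
  \<open>h = gcd a c'\<close>, then \<open>a = a' * h\<close> and \<open>c' = d * h\<close> with
  \<open>a'\<close> coprime to \<open>d\<close>, hence to \<open>c\<close>. Since \<open>c\<close>
  divides \<open>b = a' * c'\<close>, it divides \<open>c'\<close>, which gives minimality.\<close>

lemma alcm_eqI:
  fixes a b c d f k :: nat
  assumes "0 < b" "a * d = b" "f * c = b" "coprime f d" "b dvd f * d ^ k"
  shows "alcm a b = c"
proof -
  have pos: "0 < a" "0 < d" "0 < f" "0 < c" using assms by (auto intro!: gr0I)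
  have c_dvd: "c dvd d ^ k" using assms(3,5) pos by auto
  have "f dvd a" using assms by (metis coprime_dvd_mult_left_iff dvd_triv_left)
  then obtain e where e: "a = f * e" by auto
  have c: "c = e * d" using assms(2,3) e pos by auto
  have "lcm a c = e * lcm f d" unfolding e c
    by (metis lcm_mult_left mult.commute normalize_nat_def id_apply)
  also have "lcm f d = f * d" using assms(4) by (simp add: lcm_coprime)
  finally have lcm: "lcm a c = b" using assms(2) e by (simp add: ac_simps)
  have "c \<le> c'" if c': "0 < c'" "lcm a c' = b" for c'
  proof -
    define h where "h = gcd a c'"
    have "0 < h" using c' by (simp add: h_def)
    obtain a' c'' where ac: "a = a' * h" "c' = c'' * h" "coprime a' c''"
      using gcd_coprime_exists[of a c'] \<open>0 < h\<close> unfolding h_def by blast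
    have "h * b = a * c'" using prod_gcd_lcm_nat[of a c'] c' by (simp add: h_def)
    then have b: "b = a' * c'" using \<open>0 < h\<close> ac(1) by simp
    \<comment> \<open>Compare \<open>b = a' * (c'' * h)\<close> with
      \<open>b = (a' * h) * d\<close>.\<close>
    then have "c'' = d" using assms(2) ac pos \<open>0 < h\<close> by auto
    then have "coprime a' c"
      using ac(3) c_dvd by (metis coprime_divisors coprime_power_right_iff dvd_refl)
    moreover have "c dvd a' * c'" using assms(3) unfolding b[symmetric] by auto
    ultimately have "c dvd c'" by (simp add: coprime_commute coprime_dvd_mult_right_iff)
    then show ?thesis using c' by (simp add: dvd_imp_le)
  qed
  then show ?thesis unfolding alcm_def using lcm pos by (intro Least_equality) auto
qed

section \<open>Structured programs\<close>

lemma run_trans: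
  assumes "run P c t c'" "run P c' t' c''" shows "run P c (t + t') c''"
  using assms by (induction rule: run.induct) (auto simp: add.assoc intro: run.intros)

text \<open>Jump targets are absolute, so a piece of code is given as a function of its start address.\<close>

type_synonym code = "nat \<Rightarrow> instr list"

definition block :: "instr list \<Rightarrow> code" where
  "block is = (\<lambda>_. is)"

definition seq :: "code \<Rightarrow> code \<Rightarrow> code" (infixr ";;" 60) where
  "c ;; c' = (\<lambda>n. c n @ c' (n + length (c n)))"

definition unless :: "nat \<Rightarrow> code \<Rightarrow> code" where
  "unless j c = (\<lambda>n. JumpPos (Suc n + length (c (Suc n))) j # c (Suc n))"

definition repeat_while :: "code \<Rightarrow> nat \<Rightarrow> code" where
  "repeat_while c j = (\<lambda>n. c n @ [JumpPos n j])"

text \<open>Quantifying over all surrounding code \<open>ps\<close> and \<open>qs\<close> makes the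
  judgement independent of the place of the code, as composition requires. Execution ends just
  behind the code.\<close>

definition code_run :: "code \<Rightarrow> memory \<Rightarrow> nat \<Rightarrow> memory \<Rightarrow> bool" where
  "code_run c m t m' \<longleftrightarrow> (\<forall>ps qs. run (ps @ c (length ps) @ qs) (length ps, m) t
     (length ps + length (c (length ps)), m'))"

lemma code_runD:
  assumes "code_run c m t m'" "P = ps @ c n @ qs" "n = length ps"
  shows "run P (n, m) t (n + length (c n), m')"
  using assms by (simp add: code_run_def)

lemma run_single:
  assumes "pc < length P" "exec (P ! pc) (pc, m) = Some c'"
  shows "run P (pc, m) (cost (P ! pc) m) c'"
  using run_step[OF assms run_refl] by simp

lemma code_run_Nil: "code_run (block []) m 0 m"
  by (simp add: code_run_def block_def run_refl)

lemma code_run_Cons: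
  assumes "\<And>pc. exec i (pc, m) = Some (Suc pc, m')" "code_run (block is) m' t m''"
  shows "code_run (block (i # is)) m (cost i m + t) m''"
  unfolding code_run_def block_def
proof (intro allI)
  fix ps qs :: "instr list"
  let ?P = "ps @ (i # is) @ qs"
  have "run ?P (Suc (length ps), m') t (Suc (length ps) + length is, m'')"
    using code_runD[OF assms(2), of ?P "ps @ [i]" _ qs] by (simp add: block_def)
  then have "run ?P (length ps, m) (cost (?P ! length ps) m + t) (Suc (length ps) + length is, m'')"
    by (intro run_step) (auto simp: assms(1))
  then show "run ?P (length ps, m) (cost i m + t) (length ps + length (i # is), m'')" by simp
qed

lemma code_run_seq:
  assumes "code_run c m t m'" "code_run c' m' t' m''"
  shows "code_run (c ;; c') m (t + t') m''"
  unfolding code_run_def seq_def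
proof (intro allI)
  fix ps qs :: "instr list"
  let ?n = "length ps" and ?P = "ps @ (c (length ps) @ c' (length ps + length (c (length ps)))) @ qs"
  have "run ?P (?n, m) t (?n + length (c ?n), m')"
    by (rule code_runD[OF assms(1)]) auto
  moreover have "run ?P (?n + length (c ?n), m') t'
      (?n + length (c ?n) + length (c' (?n + length (c ?n))), m'')"
    by (rule code_runD[OF assms(2), of _ "ps @ c ?n"]) auto
  ultimately show "run ?P (?n, m) (t + t')
      (?n + length (c ?n @ c' (?n + length (c ?n))), m'')"
    using run_trans by (fastforce simp: add.assoc)
qed

lemma code_run_unless_skip:
  assumes "0 < m j" shows "code_run (unless j c) m (bit_len (m j)) m"
  unfolding code_run_def unless_def
proof (intro allI)
  fix ps qs :: "instr list"
  let ?n = "length ps"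
  let ?J = "JumpPos (Suc ?n + length (c (Suc ?n))) j"
  let ?P = "ps @ (?J # c (Suc ?n)) @ qs"
  have "run ?P (?n, m) (cost (?P ! ?n) m) (?n + length (?J # c (Suc ?n)), m)"
    by (rule run_single) (use assms in auto)
  then show "run ?P (?n, m) (bit_len (m j)) (?n + length (?J # c (Suc ?n)), m)" by simp
qed

lemma code_run_unless:
  assumes "\<not> 0 < m j" "code_run c m t m'"
  shows "code_run (unless j c) m (bit_len (m j) + t) m'"
  unfolding code_run_def unless_def
proof (intro allI)
  fix ps qs :: "instr list"
  let ?n = "length ps"
  let ?J = "JumpPos (Suc ?n + length (c (Suc ?n))) j"
  let ?P = "ps @ (?J # c (Suc ?n)) @ qs"
  have "run ?P (Suc ?n, m) t (Suc ?n + length (c (Suc ?n)), m')"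
    by (rule code_runD[OF assms(2), of _ "ps @ [?J]"]) auto
  then have "run ?P (?n, m) (cost (?P ! ?n) m + t) (Suc ?n + length (c (Suc ?n)), m')"
    by (intro run_step) (use assms in auto)
  then show "run ?P (?n, m) (bit_len (m j) + t) (?n + length (?J # c (Suc ?n)), m')" by simp
qed

text \<open>One pass through body and test; both loop rules below are read off from it.\<close>

lemma run_repeat_while_round:
  fixes ps qs c j
  defines "n \<equiv> length ps"
  defines "P \<equiv> ps @ repeat_while c j n @ qs"
  assumes "code_run c m t m'"
  shows "run P (n, m) (t + bit_len (m' j)) (if 0 < m' j then n else n + length (repeat_while c j n), m')"
proof -
  have P: "P = ps @ c n @ [JumpPos n j] @ qs" by (simp add: P_def repeat_while_def)
  have "run P (n, m) t (n + length (c n), m')"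
    by (rule code_runD[OF assms(3)]) (auto simp: P n_def)
  moreover have nth: "P ! (n + length (c n)) = JumpPos n j"
    by (simp add: P n_def nth_append)
  have "run P (n + length (c n), m') (cost (P ! (n + length (c n))) m')
      (if 0 < m' j then n else n + length (repeat_while c j n), m')"
    by (rule run_single, simp add: P n_def, simp only: nth) (simp add: repeat_while_def)
  ultimately show ?thesis using run_trans nth by fastforce
qed

lemma code_run_repeat_while_exit:
  assumes "code_run c m t m'" "\<not> 0 < m' j"
  shows "code_run (repeat_while c j) m (t + bit_len (m' j)) m'"
  using run_repeat_while_round[OF assms(1), of _ j] assms(2) by (auto simp: code_run_def)

lemma code_run_repeat_while_step:
  assumes "code_run c m t m'" "0 < m' j" "code_run (repeat_while c j) m' t' m''"
  shows "code_run (repeat_while c j) m (t + bit_len (m' j) + t') m''"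
  unfolding code_run_def
proof (intro allI)
  fix ps qs :: "instr list"
  let ?P = "ps @ repeat_while c j (length ps) @ qs"
  show "run ?P (length ps, m) (t + bit_len (m' j) + t')
      (length ps + length (repeat_while c j (length ps)), m'')"
    using run_trans[OF run_repeat_while_round[OF assms(1), of ps j qs]] assms(2)
      code_runD[OF assms(3), of ?P ps _ qs] by simp
qed

section \<open>Total correctness with step counts\<close>

definition bounded :: "int \<Rightarrow> memory \<Rightarrow> bool" where
  "bounded N m \<longleftrightarrow> (\<forall>i. \<bar>m i\<bar> \<le> N)"

text \<open>
  As long as all registers stay bounded by \<open>N\<close>, an instruction costs at most twice the bit length
  of \<open>N\<close>, so it suffices to count steps.
\<close>

definition achieves :: "int \<Rightarrow> code \<Rightarrow> memory \<Rightarrow> nat \<Rightarrow> (memory \<Rightarrow> bool) \<Rightarrow> bool" where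
  "achieves N c m s Q \<longleftrightarrow> (bounded N m \<longrightarrow>
     (\<exists>t m'. code_run c m t m' \<and> t \<le> s * (2 * bit_len N) \<and> bounded N m' \<and> Q m'))"

lemma bit_len_mono: "\<bar>x\<bar> \<le> N \<Longrightarrow> bit_len x \<le> bit_len N"
  unfolding bit_len_def by (auto intro!: floor_log_le_iff nat_mono)

lemma bounded_bit_len: "bounded N m \<Longrightarrow> bit_len (m i) \<le> bit_len N"
  by (simp add: bounded_def bit_len_mono)

lemma bounded_bit_len_add: "bounded N m \<Longrightarrow> bit_len (m i) + bit_len (m j) \<le> bit_len N + bit_len N"
  by (simp add: add_mono bounded_bit_len)

lemma bounded_upd: "bounded N m \<Longrightarrow> \<bar>x\<bar> \<le> N \<Longrightarrow> bounded N (m(i := x))"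
  by (simp add: bounded_def)

lemma achieves_mono:
  "achieves N c m s Q \<Longrightarrow> s \<le> s' \<Longrightarrow> (\<And>m'. Q m' \<Longrightarrow> Q' m') \<Longrightarrow> achieves N c m s' Q'"
  unfolding achieves_def by (meson le_trans mult_le_mono1)

text \<open>A weakest precondition that also demands that every written value stays within
  \<open>N\<close>. Blocks contain neither jumps nor indirect accesses, so these default to
  \<open>False\<close>.\<close>

fun block_wp :: "int \<Rightarrow> instr list \<Rightarrow> memory \<Rightarrow> (memory \<Rightarrow> bool) \<Rightarrow> bool" where
  "block_wp N [] m Q = Q m"
| "block_wp N (LoadConst i z # is) m Q = (\<bar>z\<bar> \<le> N \<and> block_wp N is (m(i := z)) Q)"
| "block_wp N (Add i j k # is) m Q = (\<bar>m j + m k\<bar> \<le> N \<and> block_wp N is (m(i := m j + m k)) Q)"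
| "block_wp N (Sub i j k # is) m Q = (\<bar>m j - m k\<bar> \<le> N \<and> block_wp N is (m(i := m j - m k)) Q)"
| "block_wp N _ m Q = False"

lemma achieves_Cons:
  assumes "achieves N (block is) m' s Q" "\<And>pc. exec i (pc, m) = Some (Suc pc, m')"
    and "bounded N m \<Longrightarrow> bounded N m' \<and> cost i m \<le> 2 * bit_len N"
  shows "achieves N (block (i # is)) m (Suc s) Q"
  unfolding achieves_def
proof
  assume "bounded N m"
  with assms(1,3) obtain t m'' where "code_run (block is) m' t m''" "t \<le> s * (2 * bit_len N)"
    "bounded N m''" "Q m''" "cost i m \<le> 2 * bit_len N"
    unfolding achieves_def by blast
  with code_run_Cons[OF assms(2) this(1)]
  show "\<exists>t m''. code_run (block (i # is)) m t m'' \<and> t \<le> Suc s * (2 * bit_len N) \<and>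
      bounded N m'' \<and> Q m''"
    by (intro exI conjI) (assumption | simp)+
qed

lemma achieves_block:
  "block_wp N is m Q \<Longrightarrow> achieves N (block is) m (length is) Q"
proof (induction "is" arbitrary: m)
  case Nil
  then show ?case by (auto simp: achieves_def intro!: exI code_run_Nil)
next
  case (Cons i "is")
  have "\<exists>m'. block_wp N is m' Q \<and> (\<forall>pc. exec i (pc, m) = Some (Suc pc, m')) \<and>
      (bounded N m \<longrightarrow> bounded N m' \<and> cost i m \<le> 2 * bit_len N)"
    using Cons.prems
    by (cases i) (simp_all add: bounded_upd bounded_bit_len_add trans_le_add1[OF bit_len_mono] mult_2)
  then show ?case using Cons.IH by (auto intro: achieves_Cons)
qed

lemma achieves_seq:
  assumes "achieves N c m s R" "\<And>m'. R m' \<Longrightarrow> achieves N c' m' s' Q"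
  shows "achieves N (c ;; c') m (s + s') Q"
  unfolding achieves_def
proof
  assume "bounded N m"
  with assms obtain t m' where 1: "code_run c m t m'" "t \<le> s * (2 * bit_len N)"
    "bounded N m'" "R m'" unfolding achieves_def by blast
  with assms(2) obtain t' m'' where "code_run c' m' t' m''" "t' \<le> s' * (2 * bit_len N)"
    "bounded N m''" "Q m''" unfolding achieves_def by blast
  with 1 code_run_seq[OF 1(1) this(1)]
  show "\<exists>t m''. code_run (c ;; c') m t m'' \<and> t \<le> (s + s') * (2 * bit_len N) \<and>
      bounded N m'' \<and> Q m''"
    by (intro exI conjI) (assumption | simp add: add_mult_distrib)+
qed

lemma achieves_unless:
  assumes "0 < m j \<Longrightarrow> Q m" "\<not> 0 < m j \<Longrightarrow> achieves N c m s Q"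
  shows "achieves N (unless j c) m (Suc s) Q"
  unfolding achieves_def
proof
  assume b: "bounded N m"
  note l = bounded_bit_len[OF b, of j]
  show "\<exists>t m''. code_run (unless j c) m t m'' \<and> t \<le> Suc s * (2 * bit_len N) \<and>
      bounded N m'' \<and> Q m''"
  proof (cases "0 < m j")
    case True
    from code_run_unless_skip[of m j c, OF True] this show ?thesis using l b assms(1)
      by (intro exI conjI) (assumption | simp)+
  next
    case False
    then obtain t m' where "code_run c m t m'" "t \<le> s * (2 * bit_len N)" "bounded N m'" "Q m'"
      using assms(2) b unfolding achieves_def by blast
    with code_run_unless[OF False this(1)] show ?thesis using l
      by (intro exI conjI) (assumption | simp)+
  qed
qed

text \<open>The index \<open>n\<close> of the invariant is a variant that drops in each round that
  continues. The body still runs when \<open>n\<close> is 0, so there are at most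
  \<open>Suc n\<close> rounds, each of \<open>s\<close> steps and one test.\<close>

lemma achieves_repeat_while:
  assumes "I n m"
    and body: "\<And>n m. I n m \<Longrightarrow>
      achieves N c m s (\<lambda>m'. if 0 < m' j then \<exists>n'<n. I n' m' else Q m')"
  shows "achieves N (repeat_while c j) m (Suc n * Suc s) Q"
  using \<open>I n m\<close>
proof (induction n arbitrary: m rule: less_induct)
  case (less n)
  show ?case unfolding achieves_def
  proof
    let ?K = "2 * bit_len N"
    assume "bounded N m"
    with body[OF less.prems] obtain t m' where 1: "code_run c m t m'" "t \<le> s * ?K"
      "bounded N m'" "if 0 < m' j then \<exists>n'<n. I n' m' else Q m'"
      unfolding achieves_def by blast
    have l: "t + bit_len (m' j) \<le> Suc s * ?K" using 1 bounded_bit_len[of N m' j] by simp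
    show "\<exists>t m'. code_run (repeat_while c j) m t m' \<and> t \<le> Suc n * Suc s * ?K \<and> bounded N m' \<and> Q m'"
    proof (cases "0 < m' j")
      case True
      with 1 obtain n' where n': "n' < n" "I n' m'" by auto
      from less.IH[OF this] 1(3) obtain t' m'' where 2: "code_run (repeat_while c j) m' t' m''"
        "t' \<le> Suc n' * Suc s * ?K" "bounded N m''" "Q m''" unfolding achieves_def by blast
      have "Suc n' * Suc s * ?K \<le> n * Suc s * ?K"
        using n' by (intro mult_le_mono) auto
      then have "t + bit_len (m' j) + t' \<le> Suc n * Suc s * ?K"
        using l 2(2) by (simp only: mult_Suc[of n] add_mult_distrib)
      with 2 code_run_repeat_while_step[OF 1(1) True 2(1)] show ?thesis by blast
    next
      case False
      have "Suc s * ?K \<le> Suc n * Suc s * ?K" by simp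
      with l have "t + bit_len (m' j) \<le> Suc n * Suc s * ?K" by (rule le_trans)
      with False 1 code_run_repeat_while_exit[OF 1(1) False] show ?thesis by auto
    qed
  qed
qed

section \<open>The program\<close>

text \<open>
  Register 10 is never written and supplies the constant \<open>0\<close>; register 13 holds loop conditions
  and doubles as the temporary of the swap.
\<close>

abbreviation (input) "rA \<equiv> 0 :: nat"
abbreviation (input) "rB \<equiv> 1 :: nat"
abbreviation (input) "rX \<equiv> 2 :: nat"
abbreviation (input) "rY \<equiv> 3 :: nat"
abbreviation (input) "rU \<equiv> 4 :: nat"
abbreviation (input) "rV \<equiv> 5 :: nat"
abbreviation (input) "rZ \<equiv> 6 :: nat"
abbreviation (input) "rW \<equiv> 7 :: nat"
abbreviation (input) "rZ' \<equiv> 8 :: nat"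
abbreviation (input) "rW' \<equiv> 9 :: nat"
abbreviation (input) "r0 \<equiv> 10 :: nat"
abbreviation (input) "rD \<equiv> 11 :: nat"
abbreviation (input) "rF \<equiv> 12 :: nat"
abbreviation (input) "rT \<equiv> 13 :: nat"

abbreviation (input) Copy :: "nat \<Rightarrow> nat \<Rightarrow> instr" where
  "Copy i j \<equiv> Add i j r0"

text \<open>\<open>rZ\<close> and \<open>rW\<close> run through the multiples of \<open>rY\<close>
  and \<open>rV\<close> by powers of two. The loop stops only once \<open>rZ\<close> has reached
  \<open>rX\<close>, so \<open>rZ'\<close> and \<open>rW'\<close> keep the values before the last
  doubling.\<close>

definition double_body :: code where
  "double_body = block [Copy rZ' rZ, Copy rW' rW, Add rZ rZ rZ, Add rW rW rW, Sub rT rX rZ]"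

text \<open>The pair is first sorted; a tie is swapped too, which is harmless. Replacing
  \<open>x\<close> by \<open>x - k y\<close> and \<open>u\<close> by \<open>u + k v\<close>
  preserves \<open>x v + y u\<close>, so only \<open>rX\<close> and \<open>rU\<close> change at the
  end.\<close>

definition euclid_body :: code where
  "euclid_body =
     block [Sub rT rX rY] ;;
     unless rT (block [Copy rT rX, Copy rX rY, Copy rY rT, Copy rT rU, Copy rU rV, Copy rV rT]) ;;
     block [Copy rZ rY, Copy rW rV] ;;
     repeat_while double_body rT ;;
     block [Sub rX rX rZ', Add rU rU rW']"

text \<open>The cofactors 1 and 0 make \<open>x v + y u\<close> start as the original
  \<open>y\<close>.\<close>

definition div_gcd :: code where
  "div_gcd = block [LoadConst rU 1, LoadConst rV 0] ;; repeat_while euclid_body rX"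

text \<open>\<open>rT\<close> receives the decrease of \<open>f\<close>, so the loop goes on exactly
  until \<open>f\<close> is stable.\<close>

definition coprime_part_body :: code where
  "coprime_part_body =
     block [Copy rX rD, Copy rY rF] ;; div_gcd ;; block [Sub rT rF rU, Copy rF rU]"

definition alcm_code :: code where
  "alcm_code =
     block [Copy rX rA, Copy rY rB] ;; div_gcd ;;
     block [Copy rD rU, Copy rF rB] ;; repeat_while coprime_part_body rT ;;
     block [Copy rX rF, Copy rY rB] ;; div_gcd ;;
     block [Copy rA rU]"

definition frame :: "nat set \<Rightarrow> memory \<Rightarrow> memory \<Rightarrow> bool" where
  "frame R m m' \<longleftrightarrow> (\<forall>i. i \<notin> R \<longrightarrow> m' i = m i)"

section \<open>Finding the multiple to subtract by doubling\<close>

text \<open>As \<open>x < 2 ^ K\<close> and \<open>y\<close> is at least 1, \<open>K + 1\<close>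
  rounds suffice. The values before the last doubling are at most \<open>b\<close>, so the doubled
  ones are at most \<open>2 * b\<close>; hence this register bound throughout.\<close>

lemma achieves_double:
  fixes m :: memory and b :: int
  assumes m: "0 < m rY" "m rY \<le> m rX" "m rX \<le> b" "m rX < 2 ^ K" "0 \<le> m rV" "m rX * m rV \<le> b"
    "m rZ = m rY" "m rW = m rV" "m r0 = 0"
  shows "achieves (2 * b) (repeat_while double_body rT) m (Suc K * 6) (\<lambda>m'.
    frame {rZ, rW, rZ', rW', rT} m m' \<and>
    (\<exists>k. m' rZ' = k * m rY \<and> m' rW' = k * m rV \<and> 0 < k \<and> k * m rY \<le> m rX \<and> m rX \<le> 2 * (k * m rY)))"
    (is "achieves _ _ _ _ ?Q")
proof -
  \<comment> \<open>\<open>n\<close> bounds the number of further doublings for which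
    \<open>rZ\<close> can stay at most \<open>x\<close>.\<close>
  define I where "I n m' \<longleftrightarrow> frame {rZ, rW, rZ', rW', rT} m m' \<and>
    (\<exists>k. m' rZ = k * m rY \<and> m' rW = k * m rV \<and> 0 < k \<and> k * m rY \<le> m rX \<and> m rX < 2 ^ n * (k * m rY))"
    for n :: nat and m' :: memory
  have "I K m" unfolding I_def
  proof (intro conjI exI)
    have "(2::int) ^ K * 1 \<le> 2 ^ K * m rY" using m by (intro mult_left_mono) auto
    then show "m rX < 2 ^ K * (1 * m rY)" using \<open>m rX < 2 ^ K\<close> by linarith
  qed (use m in \<open>auto simp: frame_def\<close>)
  moreover have "achieves (2 * b) double_body m' 5
      (\<lambda>m''. if 0 < m'' rT then \<exists>n'<n. I n' m'' else ?Q m'')" if I: "I n m'" for n m'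
  proof -
    from I obtain k where k: "m' rZ = k * m rY" "m' rW = k * m rV" "0 < k" "k * m rY \<le> m rX"
      "m rX < 2 ^ n * (k * m rY)" and fr: "frame {rZ, rW, rZ', rW', rT} m m'"
      unfolding I_def by auto
    have regs: "m' rX = m rX" "m' r0 = 0" using fr m by (auto simp: frame_def)
    \<comment> \<open>Since \<open>y\<close> is at least 1, \<open>k v\<close> is at most
      \<open>k y v\<close>, hence at most \<open>x v\<close>.\<close>
    have "k * m rV * 1 \<le> k * m rV * m rY" using m k by (intro mult_left_mono) auto
    also have "\<dots> = k * m rY * m rV" by simp
    also have "\<dots> \<le> m rX * m rV" using m k by (intro mult_right_mono) auto
    finally have w: "k * m rV \<le> b" using m by simp
    have nonneg: "0 \<le> k * m rV" "0 < k * m rY" using m k by auto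
    have next_I: "\<exists>n'<n. I n' m''" if "frame {rZ, rW, rZ', rW', rT} m m''" "m'' rZ = (2 * k) * m rY"
      "m'' rW = (2 * k) * m rV" "(2 * k) * m rY < m rX" for m''
    proof (cases n)
      \<comment> \<open>Impossible: \<open>k y\<close> would be both at most \<open>x\<close> and
        greater than \<open>x\<close>.\<close>
      case 0
      then show ?thesis using k by simp
    next
      case (Suc n')
      have "I n' m''" unfolding I_def
        by (intro conjI exI[of _ "2 * k"]) (use that k Suc in \<open>auto simp: ac_simps\<close>)
      then show ?thesis using Suc by auto
    qed
    have "block_wp (2 * b)
        [Copy rZ' rZ, Copy rW' rW, Add rZ rZ rZ, Add rW rW rW, Sub rT rX rZ] m'
        (\<lambda>m''. if 0 < m'' rT then \<exists>n'<n. I n' m'' else ?Q m'')"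
      using k nonneg w m(3) fr
      by (auto simp: regs frame_def intro!: next_I exI[of _ k])
    then show ?thesis unfolding double_body_def by (intro achieves_mono[OF achieves_block]) auto
  qed
  ultimately have "achieves (2 * b) (repeat_while double_body rT) m (Suc K * Suc 5) ?Q"
    by (rule achieves_repeat_while)
  then show ?thesis by simp
qed

section \<open>The Euclidean algorithm with cofactors\<close>

definition div_gcd_regs :: "nat set" where
  "div_gcd_regs = {rX, rY, rU, rV, rZ, rW, rZ', rW', rT}"

text \<open>Subtracting \<open>k y\<close> removes at least half of \<open>x\<close>. The product
  \<open>x y\<close> serves as the measure because swapping leaves it unchanged.\<close>

lemma euclid_round_halves:
  fixes k x y :: int
  assumes "x \<le> 2 * (k * y)" "0 < y" "x * y < 2 ^ Suc n"
  shows "(x - k * y) * y < 2 ^ n"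
proof -
  have "2 * ((x - k * y) * y) = (2 * (x - k * y)) * y" by simp
  also have "\<dots> \<le> x * y" using assms by (intro mult_right_mono) auto
  finally show ?thesis using assms(3) by simp
qed

text \<open>
  The state of the extended Euclidean algorithm on \<open>x\<close>, \<open>y\<close>: the current pair and its cofactors,
  taken without their (always opposite) signs.
\<close>

definition euclid_state :: "int \<Rightarrow> int \<Rightarrow> int \<Rightarrow> int \<Rightarrow> int \<Rightarrow> int \<Rightarrow> int \<Rightarrow> bool" where
  "euclid_state b g f x y u v \<longleftrightarrow> 0 \<le> x \<and> 0 < y \<and> x \<le> b \<and> y \<le> b \<and> 0 \<le> u \<and> 0 \<le> v \<and>
     gcd x y = g \<and> x * v + y * u = f"

lemma euclid_state_commute: "0 < x \<Longrightarrow> euclid_state b g f x y u v \<Longrightarrow> euclid_state b g f y x v u"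
  by (auto simp: euclid_state_def gcd.commute)

lemma euclid_state_step:
  assumes "euclid_state b g f x y u v" "0 < k" "k * y \<le> x"
  shows "euclid_state b g f (x - k * y) y (u + k * v) v"
proof -
  have "0 < k * y" using assms by (auto simp: euclid_state_def)
  moreover have "gcd (x - k * y) y = gcd x y"
    using gcd_add_mult[of y "- k" x] by (simp add: gcd.commute algebra_simps)
  moreover have "(x - k * y) * v + y * (u + k * v) = x * v + y * u" by (simp add: algebra_simps)
  moreover have "x - k * y \<le> b" using \<open>0 < k * y\<close> assms(1) unfolding euclid_state_def by linarith
  ultimately show ?thesis using assms by (auto simp: euclid_state_def)
qed

text \<open>Both summands of \<open>x v + y u = f\<close> are nonnegative, so each is at most
  \<open>f\<close>. A factor that is at least 1 passes the bound on to its cofactor; for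
  \<open>v\<close> this requires \<open>x\<close> to be positive.\<close>

lemma euclid_state_bounds:
  assumes "euclid_state b g f x y u v" "f \<le> b"
  shows "u \<le> b" "0 < x \<Longrightarrow> v \<le> b" "x * v \<le> b"
proof -
  have *: "0 \<le> x * v" "0 \<le> y * u" using assms by (auto simp: euclid_state_def)
  then show "x * v \<le> b" using assms unfolding euclid_state_def by linarith
  have "1 * u \<le> y * u" using assms by (intro mult_right_mono) (auto simp: euclid_state_def)
  then show "u \<le> b" using assms * unfolding euclid_state_def by linarith
  assume "0 < x"
  then have "1 * v \<le> x * v" using assms by (intro mult_right_mono) (auto simp: euclid_state_def)
  then show "v \<le> b" using assms * unfolding euclid_state_def by linarith
qed

lemma achieves_euclid_body:
  fixes m :: memory
  assumes st: "euclid_state b g f (m rX) (m rY) (m rU) (m rV)" and x: "0 < m rX"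
    and f: "f \<le> b" and b: "b < 2 ^ K" and n: "m rX * m rY < 2 ^ Suc n" and m0: "m r0 = 0"
  shows "achieves (2 * b) euclid_body m (6 * K + 18) (\<lambda>m'. frame div_gcd_regs m m' \<and>
    euclid_state b g f (m' rX) (m' rY) (m' rU) (m' rV) \<and> m' rX * m' rY < 2 ^ n)"
    (is "achieves _ _ _ _ ?Q")
proof -
  note defs = frame_def div_gcd_regs_def
  define sorted where "sorted m' \<longleftrightarrow> frame div_gcd_regs m m' \<and> m' rY \<le> m' rX \<and> 0 < m' rX \<and>
    euclid_state b g f (m' rX) (m' rY) (m' rU) (m' rV) \<and> m' rX * m' rY < 2 ^ Suc n"
    for m' :: memory
  define ready where "ready m' \<longleftrightarrow> sorted m' \<and> m' rZ = m' rY \<and> m' rW = m' rV" for m' :: memory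
  define tail where "tail = block [Sub rX rX rZ', Add rU rU rW']"
  define body where "body = block [Copy rZ rY, Copy rW rV] ;; repeat_while double_body rT ;; tail"
  have tail: "achieves (2 * b) (repeat_while double_body rT ;; tail) m' (Suc K * 6 + 2) ?Q"
    if "ready m'" for m'
  proof (rule achieves_seq[OF achieves_double[where b = b and K = K]])
    have s: "frame div_gcd_regs m m'" "m' rY \<le> m' rX" "m' rX * m' rY < 2 ^ Suc n"
      "euclid_state b g f (m' rX) (m' rY) (m' rU) (m' rV)" "0 < m' rX"
      "m' rZ = m' rY" "m' rW = m' rV"
      using that unfolding ready_def sorted_def by auto
    show "0 < m' rY" "m' rX \<le> b" "m' rX < 2 ^ K" "0 \<le> m' rV" "m' rX * m' rV \<le> b"
      "m' rY \<le> m' rX" "m' rZ = m' rY" "m' rW = m' rV" "m' r0 = 0"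
      using s b m0 euclid_state_bounds[OF s(4) f]
      by (auto simp: euclid_state_def defs)
    fix m'' assume "frame {rZ, rW, rZ', rW', rT} m' m'' \<and>
      (\<exists>k. m'' rZ' = k * m' rY \<and> m'' rW' = k * m' rV \<and> 0 < k \<and> k * m' rY \<le> m' rX \<and>
        m' rX \<le> 2 * (k * m' rY))"
    then obtain k where fr: "frame {rZ, rW, rZ', rW', rT} m' m''" and
      k: "m'' rZ' = k * m' rY" "m'' rW' = k * m' rV" "0 < k" "k * m' rY \<le> m' rX"
      "m' rX \<le> 2 * (k * m' rY)" by auto
    have regs: "m'' rX = m' rX" "m'' rY = m' rY" "m'' rU = m' rU" "m'' rV = m' rV"
      using fr by (auto simp: frame_def)
    note step = euclid_state_step[OF s(4) k(3,4)]
    have "0 < m' rY" using s by (simp add: euclid_state_def)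
    note halves = euclid_round_halves[OF k(5) this s(3)]
    have "block_wp (2 * b) [Sub rX rX rZ', Add rU rU rW'] m'' ?Q"
      using step halves euclid_state_bounds[OF step f] s(1) fr
      by (auto simp: regs k euclid_state_def defs)
    then show "achieves (2 * b) tail m'' 2 ?Q"
      unfolding tail_def by (intro achieves_mono[OF achieves_block]) auto
  qed
  have body: "achieves (2 * b) body m' (2 + (Suc K * 6 + 2)) ?Q"
    if "sorted m'" for m'
  proof -
    have "m' r0 = 0" "m' rY \<le> b" "0 < m' rY" "0 \<le> m' rV" "m' rV \<le> b"
      using that m0 euclid_state_bounds(2)[of b g f "m' rX" "m' rY" "m' rU" "m' rV"] f
      by (auto simp: sorted_def euclid_state_def defs)
    then have "block_wp (2 * b) [Copy rZ rY, Copy rW rV] m' ready"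
      using that by (auto simp: ready_def sorted_def defs)
    from achieves_seq[OF achieves_block[OF this] tail] show ?thesis unfolding body_def by simp
  qed
  have swap: "achieves (2 * b)
      (unless rT (block [Copy rT rX, Copy rX rY, Copy rY rT, Copy rT rU, Copy rU rV, Copy rV rT]))
      m' 7 sorted" if m': "m' = m(rT := m rX - m rY)" for m'
  proof -
    note bds = euclid_state_bounds[OF st f]
    have "sorted m'" if "0 < m' rT"
      using that st x n by (auto simp: m' sorted_def defs)
    moreover have "block_wp (2 * b)
        [Copy rT rX, Copy rX rY, Copy rY rT, Copy rT rU, Copy rU rV, Copy rV rT] m' sorted"
      if "\<not> 0 < m' rT"
      using that st x n m0 bds euclid_state_commute[OF x st]
      by (auto simp: m' sorted_def defs euclid_state_def mult.commute)
    ultimately show ?thesis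
      by (intro achieves_mono[OF achieves_unless[where s = 6]] achieves_mono[OF achieves_block]) auto
  qed
  have "block_wp (2 * b) [Sub rT rX rY] m (\<lambda>m'. m' = m(rT := m rX - m rY))"
    using st by (auto simp: euclid_state_def)
  \<comment> \<open>The steps add up as 1 for the comparison, 7 for the swap, 2 copies,
    \<open>6 * K + 6\<close> for the doubling and 2 for the update.\<close>
  from achieves_seq[OF achieves_block[OF this] achieves_seq[OF swap body]] show ?thesis
    unfolding euclid_body_def tail_def[symmetric] body_def[symmetric] by (rule achieves_mono) auto
qed

text \<open>Two initialisations, then at most \<open>2 * K + 1\<close> rounds because
  \<open>x y < 2 ^ (2 * K)\<close>; a round takes \<open>6 * K + 18\<close> steps and a
  test.\<close>

definition div_gcd_steps :: "nat \<Rightarrow> nat" where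
  "div_gcd_steps K = 2 + Suc (2 * K) * (6 * K + 19)"

lemma achieves_div_gcd:
  fixes m :: memory
  assumes x: "0 < m rX" "m rX \<le> b" and y: "0 < m rY" "m rY \<le> b"
    and b: "b < 2 ^ K" and m0: "m r0 = 0"
  shows "achieves (2 * b) div_gcd m (div_gcd_steps K) (\<lambda>m'. frame div_gcd_regs m m' \<and>
    m' rU = m rY div gcd (m rX) (m rY))" (is "achieves _ _ _ _ ?Q")
proof -
  let ?g = "gcd (m rX) (m rY)"
  define I where "I n m' \<longleftrightarrow> frame div_gcd_regs m m' \<and> 0 < m' rX \<and>
    euclid_state b ?g (m rY) (m' rX) (m' rY) (m' rU) (m' rV) \<and> m' rX * m' rY < 2 ^ n"
    for n :: nat and m' :: memory
  have body: "achieves (2 * b) euclid_body m' (6 * K + 18)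
      (\<lambda>m''. if 0 < m'' rX then \<exists>n'<n. I n' m'' else ?Q m'')" if I: "I n m'" for n m'
  proof (cases n)
    \<comment> \<open>Impossible, since the positive integer \<open>x y\<close> would be less than
      1.\<close>
    case 0
    have "0 < m' rX * m' rY" using I by (auto simp: I_def euclid_state_def)
    then show ?thesis using I 0 by (auto simp: I_def)
  next
    case (Suc n')
    have fr: "frame div_gcd_regs m m'" using I by (simp add: I_def)
    show ?thesis
    proof (rule achieves_mono[OF achieves_euclid_body[where b = b and K = K and n = n']])
      show "m' r0 = 0" using fr m0 by (simp add: frame_def div_gcd_regs_def)
      fix m'' assume *: "frame div_gcd_regs m' m'' \<and>
        euclid_state b ?g (m rY) (m'' rX) (m'' rY) (m'' rU) (m'' rV) \<and> m'' rX * m'' rY < 2 ^ n'"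
      then have fr'': "frame div_gcd_regs m m''" using fr by (simp add: frame_def)
      show "if 0 < m'' rX then \<exists>n'<n. I n' m'' else ?Q m''"
      proof (cases "0 < m'' rX")
        case True
        then show ?thesis using * fr'' Suc by (auto simp: I_def)
      next
        case False
        \<comment> \<open>With \<open>x = 0\<close> the gcd is \<open>y\<close> itself, and the
          invariant \<open>x v + y u\<close> reduces to \<open>y u\<close>.\<close>
        then have "m'' rY = ?g" "m rY = m'' rY * m'' rU" "0 < m'' rY"
          using * by (auto simp: euclid_state_def)
        then show ?thesis using False fr'' by (metis nonzero_mult_div_cancel_left less_irrefl)
      qed
    qed (use I Suc y b in \<open>auto simp: I_def\<close>)
  qed
  have xy: "m rX * m rY < 2 ^ (2 * K)"
  proof -
    have "m rX * m rY < 2 ^ K * 2 ^ K" using x y b by (intro mult_strict_mono) auto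
    then show ?thesis by (simp add: mult_2 power_add)
  qed
  have "block_wp (2 * b) [LoadConst rU 1, LoadConst rV 0] m (I (2 * K))"
    using x y xy by (auto simp: I_def euclid_state_def frame_def div_gcd_regs_def)
  from achieves_seq[OF achieves_block[OF this] achieves_repeat_while[where I = I, OF _ body]]
  show ?thesis unfolding div_gcd_def by (rule achieves_mono) (auto simp: div_gcd_steps_def)
qed

section \<open>Removing from b all factors shared with d\<close>

lemma achieves_coprime_part_body:
  fixes m :: memory
  assumes d: "0 < m rD" "m rD \<le> b" and f: "0 < m rF" "m rF \<le> b" and b: "b < 2 ^ K"
    and m0: "m r0 = 0"
  shows "achieves (2 * b) coprime_part_body m (div_gcd_steps K + 4) (\<lambda>m'.
    frame (insert rF div_gcd_regs) m m' \<and> m' rF = m rF div gcd (m rD) (m rF) \<and>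
    m' rT = m rF - m rF div gcd (m rD) (m rF))" (is "achieves _ _ _ _ ?Q")
proof -
  note defs = frame_def div_gcd_regs_def
  define R where "R m' \<longleftrightarrow> frame div_gcd_regs m m' \<and> m' rX = m rD \<and> m' rY = m rF" for m' :: memory
  define R' where "R' m' \<longleftrightarrow> frame div_gcd_regs m m' \<and> m' rU = m rF div gcd (m rD) (m rF)"
    for m' :: memory
  have "block_wp (2 * b) [Copy rX rD, Copy rY rF] m R"
    using d f m0 by (auto simp: R_def defs)
  note first = achieves_block[OF this]
  have middle: "achieves (2 * b) div_gcd m' (div_gcd_steps K) R'" if "R m'" for m'
    using that d f b m0
    by (intro achieves_mono[OF achieves_div_gcd[where b = b]]) (auto simp: R_def R'_def defs)
  have "achieves (2 * b) (block [Sub rT rF rU, Copy rF rU]) m' 2 ?Q" if "R' m'" for m'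
  proof -
    have "0 \<le> m rF div gcd (m rD) (m rF)" "m rF div gcd (m rD) (m rF) \<le> m rF"
      using f d zdiv_mono2[of "m rF" 1 "gcd (m rD) (m rF)"]
      by (auto simp: pos_imp_zdiv_nonneg_iff int_one_le_iff_zero_less)
    then have "block_wp (2 * b) [Sub rT rF rU, Copy rF rU] m' ?Q"
      using that f m0 by (auto simp: R'_def defs)
    then show ?thesis by (intro achieves_mono[OF achieves_block]) auto
  qed
  from achieves_seq[OF first achieves_seq[OF middle this]] show ?thesis
    unfolding coprime_part_body_def by (rule achieves_mono) auto
qed

text \<open>Each round divides \<open>f\<close> by \<open>g = gcd d f\<close>. As \<open>g\<close>
  divides \<open>d\<close>, one more power of \<open>d\<close> makes up for the loss in
  \<open>b dvd f * d ^ k\<close>. If \<open>g > 1\<close>, then \<open>f\<close> at least halves, so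
  there are at most \<open>K + 1\<close> rounds; if \<open>f\<close> is stable, then
  \<open>g = 1\<close>.\<close>

lemma achieves_coprime_part:
  fixes m :: memory
  assumes d: "0 < m rD" "m rD \<le> b" and f: "m rF = b" and b: "0 < b" "b < 2 ^ K"
    and m0: "m r0 = 0"
  shows "achieves (2 * b) (repeat_while coprime_part_body rT) m (Suc K * (div_gcd_steps K + 5))
    (\<lambda>m'. frame (insert rF div_gcd_regs) m m' \<and> 0 < m' rF \<and> m' rF dvd b \<and>
      coprime (m' rF) (m rD) \<and> (\<exists>k. b dvd m' rF * m rD ^ k))"
    (is "achieves _ _ _ _ ?Q")
proof -
  define I where "I n m' \<longleftrightarrow> frame (insert rF div_gcd_regs) m m' \<and> 0 < m' rF \<and> m' rF dvd b \<and>
      m' rF < 2 ^ n \<and> (\<exists>k. b dvd m' rF * m rD ^ k)" for n :: nat and m' :: memory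
  have "I K m" using f b by (auto simp: I_def frame_def)
  moreover have "achieves (2 * b) coprime_part_body m' (div_gcd_steps K + 4)
      (\<lambda>m''. if 0 < m'' rT then \<exists>n'<n. I n' m'' else ?Q m'')" if I: "I n m'" for n m'
  proof (rule achieves_mono[OF achieves_coprime_part_body[where b = b and K = K]])
    have regs: "m' rD = m rD" "m' r0 = 0" and fr: "frame (insert rF div_gcd_regs) m m'"
      using I m0 by (auto simp: I_def frame_def div_gcd_regs_def)
    show "0 < m' rD" "m' rD \<le> b" "0 < m' rF" "m' rF \<le> b" "b < 2 ^ K" "m' r0 = 0"
      using regs d b I by (auto simp: I_def intro: zdvd_imp_le)
    fix m'' assume *: "frame (insert rF div_gcd_regs) m' m'' \<and>
      m'' rF = m' rF div gcd (m' rD) (m' rF) \<and> m'' rT = m' rF - m' rF div gcd (m' rD) (m' rF)"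
    define g where "g = gcd (m rD) (m' rF)"
    have g: "m' rF = g * m'' rF" "g dvd m rD" using * regs by (auto simp: g_def)
    have g_pos: "0 < g" using d by (simp add: g_def)
    have rT: "m'' rT = g * m'' rF - m'' rF" using * g(1) by simp
    have pos: "0 < m' rF" "0 < m'' rF" using I g g_pos by (auto simp: I_def zero_less_mult_iff)
    have fr'': "frame (insert rF div_gcd_regs) m m''" using fr * by (auto simp: frame_def)
    obtain k where "b dvd m' rF * m rD ^ k" using I by (auto simp: I_def)
    also have "m' rF * m rD ^ k dvd m'' rF * m rD ^ Suc k"
      using mult_dvd_mono[OF g(2) dvd_refl, of "m'' rF * m rD ^ k"] by (simp add: g(1) ac_simps)
    finally have dvd: "\<exists>k. b dvd m'' rF * m rD ^ k" by blast
    have dvd': "m'' rF dvd b" using I g(1) by (auto simp: I_def intro: dvd_mult_right)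
    show "if 0 < m'' rT then \<exists>n'<n. I n' m'' else ?Q m''"
    proof (cases "0 < m'' rT")
      case True
      then have "g \<noteq> 1" by (auto simp: rT)
      then have "1 < g" using g_pos by simp
      then have "2 * m'' rF \<le> m' rF" unfolding g(1) using pos by (intro mult_right_mono) auto
      moreover have "m' rF < 2 ^ n" using I by (simp add: I_def)
      \<comment> \<open>\<open>n = 0\<close> is excluded because \<open>f\<close> would be less than
        1.\<close>
      ultimately obtain n' where "n = Suc n'" "m'' rF < 2 ^ n'" using pos by (cases n) auto
      then have "I n' m''" "n' < n" unfolding I_def using fr'' pos dvd dvd' by blast+
      with True show ?thesis by auto
    next
      case False
      then have "g * m'' rF \<le> 1 * m'' rF" by (simp add: rT)
      then have "g = 1" using pos g_pos by (simp add: mult_le_cancel_right)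
      then have "m' rF = m'' rF" using g(1) by simp
      then have "coprime (m'' rF) (m rD)"
        using \<open>g = 1\<close> unfolding g_def by (simp add: coprime_iff_gcd_eq_1 gcd.commute)
      with False show ?thesis using fr'' pos dvd dvd' by auto
    qed
  qed simp
  ultimately have "achieves (2 * b) (repeat_while coprime_part_body rT) m
      (Suc K * Suc (div_gcd_steps K + 4)) ?Q"
    by (rule achieves_repeat_while)
  then show ?thesis by (simp add: add.commute)
qed

section \<open>The whole program and its running time\<close>

text \<open>Two direct uses of \<open>div_gcd\<close>, at most \<open>K + 1\<close> rounds of the
  loop with one use, four instructions and a test each, and 7 further instructions.\<close>

definition alcm_steps :: "nat \<Rightarrow> nat" where
  "alcm_steps K = 2 * div_gcd_steps K + Suc K * (div_gcd_steps K + 5) + 7"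

lemma achieves_alcm_code:
  fixes a b :: nat
  assumes ab: "0 < a" "0 < b" "a dvd b" and b: "b < 2 ^ K"
  defines "m \<equiv> input_memory [int a, int b]"
  shows "achieves (2 * int b) alcm_code m (alcm_steps K) (\<lambda>m'. m' rA = int (alcm a b))"
    (is "achieves ?N _ _ _ ?Q")
proof -
  note defs = frame_def div_gcd_regs_def
  let ?S = "insert rF div_gcd_regs" let ?T = "insert rD (insert rF div_gcd_regs)"
  have m: "m rA = int a" "m rB = int b" "m r0 = 0" by (simp_all add: m_def input_memory_def)
  have b': "int b < 2 ^ K" using b by (metis of_nat_less_iff of_nat_numeral of_nat_power)
  have le: "a \<le> b" using ab by (simp add: dvd_imp_le)
  define d where "d = b div a"
  have d: "a * d = b" "0 < d" "d \<le> b" using ab le by (auto simp: d_def div_greater_zero_iff)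
  \<comment> \<open>\<open>R1\<close> to \<open>R6\<close> are the assertions between the seven
    pieces. \<open>?T\<close> omits \<open>rA\<close>, \<open>rB\<close> and \<open>r0\<close>, so
    the inputs and the constant 0 survive until the last piece.\<close>
  define R1 where "R1 m' \<longleftrightarrow> frame ?T m m' \<and> m' rX = int a \<and> m' rY = int b" for m' :: memory
  define R2 where "R2 m' \<longleftrightarrow> frame ?T m m' \<and> m' rU = int d" for m' :: memory
  define R3 where "R3 m' \<longleftrightarrow> frame ?T m m' \<and> m' rD = int d \<and> m' rF = int b" for m' :: memory
  define R4 where "R4 m' \<longleftrightarrow> frame ?T m m' \<and> (\<exists>f. m' rF = int f \<and> f * alcm a b = b)"
    for m' :: memory
  define R5 where "R5 m' \<longleftrightarrow> frame ?T m m' \<and> m' rY = int b \<and>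
    (\<exists>f. m' rX = int f \<and> f * alcm a b = b)" for m' :: memory
  define R6 where "R6 m' \<longleftrightarrow> frame ?T m m' \<and> m' rU = int (alcm a b)" for m' :: memory
  have "block_wp ?N [Copy rX rA, Copy rY rB] m R1"
    using m le by (auto simp: R1_def defs)
  note c1 = achieves_block[OF this]
  have c2: "achieves ?N div_gcd m' (div_gcd_steps K) R2" if "R1 m'" for m'
  proof -
    \<comment> \<open>As \<open>a\<close> divides \<open>b\<close>, dividing \<open>b\<close> by the
      gcd yields \<open>d\<close>.\<close>
    have "gcd (int a) (int b) = int a" "int b div int a = int d"
      using ab by (simp_all add: gcd_proj1_if_dvd d_def zdiv_int)
    then show ?thesis using that ab m b' le
      by (intro achieves_mono[OF achieves_div_gcd[where b = "int b"]]) (auto simp: R1_def R2_def defs)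
  qed
  have c3: "achieves ?N (block [Copy rD rU, Copy rF rB]) m' 2 R3" if "R2 m'" for m'
  proof -
    have "block_wp ?N [Copy rD rU, Copy rF rB] m' R3"
      using that m d by (auto simp: R2_def R3_def defs)
    then show ?thesis by (intro achieves_mono[OF achieves_block]) auto
  qed
  have c4: "achieves ?N (repeat_while coprime_part_body rT) m' (Suc K * (div_gcd_steps K + 5)) R4"
    if R3: "R3 m'" for m'
  proof (rule achieves_mono[OF achieves_coprime_part[where b = "int b" and K = K]])
    fix m'' assume *: "frame ?S m' m'' \<and> 0 < m'' rF \<and> m'' rF dvd int b \<and>
      coprime (m'' rF) (m' rD) \<and> (\<exists>k. int b dvd m'' rF * m' rD ^ k)"
    define f where "f = nat (m'' rF)"
    have f: "m'' rF = int f" using * by (simp add: f_def)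
    have m'd: "m' rD = int d" using R3 by (simp add: R3_def)
    obtain k where "int b dvd int (f * d ^ k)" using * unfolding f m'd by auto
    then have k: "b dvd f * d ^ k" by (simp only: int_dvd_int_iff)
    have "f dvd b" "coprime f d" using * unfolding f m'd by auto
    then obtain c where "f * c = b" by (auto elim: dvdE)
    moreover from this have "alcm a b = c"
      by (intro alcm_eqI[OF ab(2) d(1) _ \<open>coprime f d\<close> k])
    ultimately show "R4 m''" using R3 * f by (auto simp: R3_def R4_def frame_def)
  qed (use R3 d ab b' m in \<open>auto simp: R3_def defs\<close>)
  have c5: "achieves ?N (block [Copy rX rF, Copy rY rB]) m' 2 R5" if R4: "R4 m'" for m'
  proof -
    obtain f where fc: "m' rF = int f" "f * alcm a b = b" using R4 by (auto simp: R4_def)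
    then have "f \<le> b" using dvd_imp_le[OF dvd_triv_left[of f "alcm a b"]] ab(2) by simp
    then have "block_wp ?N [Copy rX rF, Copy rY rB] m' R5"
      using R4 m fc by (auto simp: R4_def R5_def defs)
    then show ?thesis by (intro achieves_mono[OF achieves_block]) auto
  qed
  have c6: "achieves ?N div_gcd m' (div_gcd_steps K) R6" if R5: "R5 m'" for m'
  proof -
    obtain f where fc: "m' rX = int f" "m' rY = int b" "f * alcm a b = b"
      using R5 by (auto simp: R5_def)
    have f: "f dvd b" using dvd_triv_left[of f "alcm a b"] fc(3) by simp
    then have f0: "0 < f" using ab(2) by (rule dvd_pos_nat[rotated])
    have "f \<le> b" using f ab(2) by (rule dvd_imp_le)
    moreover have "gcd (int f) (int b) = int f" "int b div int f = int (alcm a b)"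
      using f f0 nonzero_mult_div_cancel_left[of f "alcm a b"] fc(3)
      by (simp_all add: gcd_proj1_if_dvd flip: zdiv_int)
    ultimately show ?thesis using R5 fc f0 ab b' m
      by (intro achieves_mono[OF achieves_div_gcd[where b = "int b"]]) (auto simp: R5_def R6_def defs)
  qed
  have c7: "achieves ?N (block [Copy rA rU]) m' 1 ?Q" if "R6 m'" for m'
  proof -
    have "alcm a b dvd b" using alcm_welldefined[OF ab] by (metis dvd_lcm2)
    then have "alcm a b \<le> b" using ab by (simp add: dvd_imp_le)
    then have "block_wp ?N [Copy rA rU] m' ?Q" using that m by (auto simp: R6_def defs)
    then show ?thesis by (intro achieves_mono[OF achieves_block]) auto
  qed
  note c67 = achieves_seq[OF c6 c7]
  note c567 = achieves_seq[OF c5 c67]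
  note c4567 = achieves_seq[OF c4 c567]
  note c34567 = achieves_seq[OF c3 c4567]
  note c234567 = achieves_seq[OF c2 c34567]
  from achieves_seq[OF c1 c234567] show ?thesis
    unfolding alcm_code_def by (rule achieves_mono) (auto simp: alcm_steps_def)
qed

text \<open>Lower powers of \<open>K\<close> are absorbed into the highest one, so coefficients add:
  12 + 44 + 21 = 77, then 3 * 77 + 77 + 5 + 12 = 325.\<close>

lemma alcm_steps_le:
  assumes "0 < K" shows "alcm_steps K \<le> 325 * K ^ 3"
proof -
  have K: "1 \<le> K" "1 \<le> K * K" "K \<le> K * K" "K * K \<le> K * (K * K)" using assms by auto
  have "div_gcd_steps K \<le> 12 * (K * K) + 44 * K + 21"
    by (simp add: div_gcd_steps_def algebra_simps)
  also have "\<dots> \<le> 77 * (K * K)" using K by linarith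
  finally have F: "div_gcd_steps K \<le> 77 * (K * K)" .
  then have "K * div_gcd_steps K \<le> K * (77 * (K * K))" by (rule mult_le_mono2)
  then have "alcm_steps K \<le> 3 * (77 * (K * K)) + 77 * (K * (K * K)) + 5 * K + 12"
    using F unfolding alcm_steps_def by (simp only: add_mult_distrib add_mult_distrib2 mult_Suc)
  also have "\<dots> \<le> 325 * (K * (K * K))" using K by linarith
  finally show ?thesis by (simp add: power3_eq_cube ac_simps)
qed

theorem theorem18:
  "\<exists>(P :: instr list) (p :: real poly). \<forall>a b :: nat. 0 < a \<longrightarrow> 0 < b \<longrightarrow> a dvd b \<longrightarrow>
     (\<exists>t. ram_computes P [int a, int b] (int (alcm a b)) t \<and> real t \<le> poly p (log 2 (real b)))"
proof -
  \<comment> \<open>At most \<open>325 * K ^ 3\<close> steps of cost at most \<open>2 * K\<close>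
    give \<open>650 * K ^ 4\<close>, and \<open>K\<close> is at most
    \<open>2 + log 2 b\<close>.\<close>
  let ?P = "alcm_code 0" and ?p = "[:650:] * [:2, 1:] ^ 4 :: real poly"
  have "\<exists>t. ram_computes ?P [int a, int b] (int (alcm a b)) t \<and> real t \<le> poly ?p (log 2 (real b))"
    if ab: "0 < a" "0 < b" "a dvd b" for a b
  proof -
    let ?m = "input_memory [int a, int b]"
    \<comment> \<open>\<open>K\<close> is the bit length of the register bound \<open>2 * b\<close>
      and at the same time an exponent with \<open>b < 2 ^ K\<close>.\<close>
    define K where "K = bit_len (2 * int b)"
    have K: "K = floor_log b + 2" using ab by (simp add: K_def bit_len_def floor_log_twice nat_mult_distrib)
    have "\<bar>?m i\<bar> \<le> 2 * int b" for i
      using ab dvd_imp_le[of a b] by (auto simp: input_memory_def nth_Cons split: nat.split)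
    then have m: "bounded (2 * int b) ?m" by (simp add: bounded_def)
    have "b < 2 ^ K" using floor_log_exp2_gt[of b] by (simp add: K)
    from achieves_alcm_code[OF ab this] obtain t m' where
      t: "code_run alcm_code ?m t m'" "t \<le> alcm_steps K * (2 * K)" "m' 0 = int (alcm a b)"
      using m unfolding achieves_def K_def by blast
    have "ram_computes ?P [int a, int b] (int (alcm a b)) t"
      using code_runD[OF t(1), of ?P "[]" 0 "[]"] t(3) by (auto simp: ram_computes_def)
    moreover have "real t \<le> poly ?p (log 2 (real b))"
    proof -
      have "t \<le> 325 * K ^ 3 * (2 * K)"
        using t(2) mult_le_mono1[OF alcm_steps_le[of K], of "2 * K"] K by linarith
      also have "\<dots> = 650 * K ^ 4" by (simp add: power3_eq_cube power4_eq_xxxx)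
      finally have "real t \<le> real (650 * K ^ 4)" by (simp only: of_nat_le_iff)
      then have t_le: "real t \<le> 650 * real K ^ 4" by simp
      have "real K \<le> 2 + log 2 (real b)"
        using floor_log_exp2_le[of b] ab by (simp add: K le_log2_of_power)
      then have "650 * real K ^ 4 \<le> 650 * (2 + log 2 (real b)) ^ 4"
        by (intro mult_left_mono power_mono) auto
      with t_le show ?thesis by (simp add: poly_power)
    qed
    ultimately show ?thesis by blast
  qed
  then show ?thesis by blast
qed

end
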